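(* Let $M\in\mathbb{R}^{m\times d}$ with $m<d$ have linearly independent rows, let $\Omega\in\mathbb{R}^{p\times d}$, and let $\Lambda\subseteq\{1,\dots,p\}$ be a fixed cosupport. Then the following are equivalent. (i) For every $x_0\in\mathbb{R}^d$ with cosupport $\Lambda$, the analysis $\ell_1$-minimization problem $$\min_{x\in\mathbb{R}^d}\|\Omega x\|_1\quad\text{subject to}\quad Mx=Mx_0$$ has $x_0$ as its unique minimizer. (ii) For every $z\in\operatorname{Null}(M)$ with $z\ne0$, $$\sup_{x_\Lambda\in\mathbb{R}^d:\ \Omega_\Lambda x_\Lambda=0}\left|\left\langle \Omega_{\Lambda^c}z,\ \operatorname{sign}(\Omega_{\Lambda^c}x_\Lambda)\right\rangle\right|<\|\Omega_\Lambda z\|_1 .$$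
   Context: The cosupport of a vector $x\in\mathbb{R}^d$ with respect to $\Omega\in\mathbb{R}^{p\times d}$ is the index set of zero entries of $\Omega x$, i.e. $\{i:(\Omega x)_i=0\}$. "$\Lambda$ is a fixed cosupport" means that $\Lambda$ is the cosupport of some vector in $\mathbb{R}^d$. For an index set $\Lambda\subseteq\{1,\dots,p\}$, $\Omega_\Lambda$ is the submatrix of $\Omega$ consisting of the rows indexed by $\Lambda$, and $\Lambda^c$ is the complement of $\Lambda$ in $\{1,\dots,p\}$. The function $\operatorname{sign}$ acts entrywise, with $\operatorname{sign}(0)=0$. *)

theory Defs
  imports "HOL-Analysis.Analysis"
begin

text \<open>
  The set \<open>rows M\<close> forgets repetitions, so independence of the rows as a family is
  independence of that set together with injectivity of the row map.
\<close>

definition rows_lin_indep :: "real^'d^'m \<Rightarrow> bool" where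
  "rows_lin_indep M \<longleftrightarrow> inj (\<lambda>i. row i M) \<and> independent (rows M)"

definition null_space :: "real^'d^'m \<Rightarrow> (real^'d) set" where
  "null_space M = {z. M *v z = 0}"

definition cosupport :: "real^'d^'p \<Rightarrow> real^'d \<Rightarrow> 'p set" where
  "cosupport \<Omega> x = {i. (\<Omega> *v x) $ i = 0}"

definition sign_vec :: "real^'p \<Rightarrow> real^'p" where
  "sign_vec v = (\<chi> i. sgn (v $ i))"

text \<open>
  A vector indexed by a subset \<open>I\<close> of the row indices is represented by the entries in \<open>I\<close>
  of a vector indexed by all rows: the entries of \<open>\<Omega>\<^sub>I x\<close> are those of
  \<open>\<Omega> x\<close> at \<open>i \<in> I\<close>. The next three definitions are the \<open>\<ell>\<^sub>1\<close>
  norm, the inner product and being the zero vector for such subvectors.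
\<close>

definition l1_norm_on :: "'p set \<Rightarrow> real^'p \<Rightarrow> real" where
  "l1_norm_on I v = (\<Sum>i\<in>I. \<bar>v $ i\<bar>)"

definition inner_on :: "'p set \<Rightarrow> real^'p \<Rightarrow> real^'p \<Rightarrow> real" where
  "inner_on I u v = (\<Sum>i\<in>I. u $ i * v $ i)"

definition zero_on :: "'p set \<Rightarrow> real^'p \<Rightarrow> bool" where
  "zero_on I v \<longleftrightarrow> (\<forall>i\<in>I. v $ i = 0)"

abbreviation l1_norm :: "real^'p \<Rightarrow> real" where
  "l1_norm \<equiv> l1_norm_on UNIV"

definition unique_minimizer :: "('a \<Rightarrow> real) \<Rightarrow> ('a \<Rightarrow> bool) \<Rightarrow> 'a \<Rightarrow> bool" where
  "unique_minimizer f P x0 \<longleftrightarrow>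
     is_arg_min f P x0 \<and> (\<forall>x. is_arg_min f P x \<longrightarrow> x = x0)"

text \<open>
  The real-valued supremum of \<open>\<bar>\<langle>\<Omega>\<^sub>I z, sign (\<Omega>\<^sub>I x)\<rangle>\<bar>\<close>, with
  \<open>I = - \<Lambda>\<close>, over all \<open>x\<close> in the kernel of \<open>\<Omega>\<^sub>\<Lambda>\<close> is a genuine supremum:
  the index set contains 0 and the values are bounded.
\<close>

lemma sign_pairing_sup_well_defined:
  fixes \<Omega> :: "real^'d^'p"
  shows "{x. zero_on \<Lambda> (\<Omega> *v x)} \<noteq> {}"
    and "bdd_above ((\<lambda>x. \<bar>inner_on (- \<Lambda>) (\<Omega> *v z) (sign_vec (\<Omega> *v x))\<bar>) ` {x. zero_on \<Lambda> (\<Omega> *v x)})"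
proof -
  have "zero_on \<Lambda> (\<Omega> *v 0)"
    by (simp add: zero_on_def)
  then show "{x. zero_on \<Lambda> (\<Omega> *v x)} \<noteq> {}"
    by blast
  have "\<bar>inner_on (- \<Lambda>) u (sign_vec v)\<bar> \<le> l1_norm_on (- \<Lambda>) u" for u v :: "real^'p"
    unfolding inner_on_def l1_norm_on_def sign_vec_def
    by (rule order_trans[OF sum_abs], rule sum_mono) (simp add: abs_mult abs_sgn_eq)
  then show "bdd_above ((\<lambda>x. \<bar>inner_on (- \<Lambda>) (\<Omega> *v z) (sign_vec (\<Omega> *v x))\<bar>) ` {x. zero_on \<Lambda> (\<Omega> *v x)})"
    by (auto intro!: bdd_aboveI2)
qed

end

theory Submission
  imports Defs
begin

text \<open>
  Moving from \<open>x\<close> with cosupport \<open>\<Lambda>\<close> to \<open>x + t z\<close> with \<open>z\<close> in the kernel of \<open>M\<close> changes the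
  objective by at least \<open>t \<langle>\<Omega> z, sign (\<Omega> x)\<rangle> + t \<parallel>\<Omega>\<^sub>\<Lambda> z\<parallel>\<^sub>1\<close>, with equality for small
  \<open>t > 0\<close>. Applied to \<open>z\<close> and \<open>- z\<close>, this gives the equivalence pointwise for all \<open>x\<close> of
  cosupport exactly \<open>\<Lambda>\<close>. A general \<open>x\<close> with \<open>\<Omega>\<^sub>\<Lambda> x = 0\<close> is perturbed to \<open>x \<plusminus> t y\<close>, where
  \<open>y\<close> has cosupport \<open>\<Lambda>\<close>: both have cosupport \<open>\<Lambda>\<close> and the sign vector of \<open>x\<close> is the average of
  theirs. Strictness survives the supremum because there are only finitely many sign vectors.
\<close>

section \<open>Unique minimizers, sign vectors and small multiples\<close>

lemma unique_minimizer_iff: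
  "unique_minimizer f P x0 \<longleftrightarrow> P x0 \<and> (\<forall>x. P x \<longrightarrow> x \<noteq> x0 \<longrightarrow> f x0 < f x)"
proof
  assume min: "unique_minimizer f P x0"
  then have le: "f x0 \<le> f y" if "P y" for y
    using that by (auto simp: unique_minimizer_def is_arg_min_linorder)
  have "f x0 < f x" if "P x" "x \<noteq> x0" for x
  proof (rule ccontr)
    assume "\<not> f x0 < f x"
    \<comment> \<open>A feasible point no worse than \<open>x0\<close> is itself a minimizer,
      against uniqueness.\<close>
    then have "f x \<le> f y" if "P y" for y
      using le[OF that] by linarith
    with \<open>P x\<close> have "is_arg_min f P x"
      by (simp add: is_arg_min_linorder)
    with min \<open>x \<noteq> x0\<close> show False
      by (simp add: unique_minimizer_def)
  qed
  with min show "P x0 \<and> (\<forall>x. P x \<longrightarrow> x \<noteq> x0 \<longrightarrow> f x0 < f x)"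
    by (simp add: unique_minimizer_def is_arg_min_linorder)
next
  assume x0: "P x0 \<and> (\<forall>x. P x \<longrightarrow> x \<noteq> x0 \<longrightarrow> f x0 < f x)"
  then have "f x0 \<le> f x" if "P x" for x
    using that by (cases "x = x0") (auto intro: less_imp_le)
  moreover have "x = x0" if "P x" "f x \<le> f x0" for x
    using x0 that by (meson not_le)
  ultimately show "unique_minimizer f P x0"
    using x0 by (auto simp: unique_minimizer_def is_arg_min_linorder)
qed

text \<open>A sign vector is determined by its sets of positive and negative indices, so
  \<open>g\<close> on pairs of sets covers the range. Overlapping pairs do no harm, as a finite
  superset suffices.\<close>

lemma finite_range_sign_vec: "finite (range (sign_vec :: real^'p \<Rightarrow> real^'p))"
proof -
  define g :: "'p set \<times> 'p set \<Rightarrow> real^'p"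
    where "g = (\<lambda>(A, B). \<chi> i. if i \<in> A then 1 else if i \<in> B then -1 else 0)"
  have "sign_vec v = g ({i. v $ i > 0}, {i. v $ i < 0})" for v
    by (auto simp: g_def sign_vec_def vec_eq_iff sgn_if)
  then have "range sign_vec \<subseteq> range g"
    by blast
  then show ?thesis
    by (rule finite_subset) simp
qed

text \<open>For each entry the condition holds for all sufficiently small \<open>t > 0\<close>, and
  there are finitely many entries.\<close>

lemma ex_small_multiple:
  fixes u v :: "real^'p"
  obtains t :: real where "t > 0" "\<And>i. u $ i \<noteq> 0 \<Longrightarrow> t * \<bar>v $ i\<bar> < \<bar>u $ i\<bar>"
proof -
  have "\<forall>\<^sub>F t in at_right (0::real). u $ i \<noteq> 0 \<longrightarrow> t * \<bar>v $ i\<bar> < \<bar>u $ i\<bar>" for i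
  proof (cases "u $ i = 0")
    case False
    have "((\<lambda>t. t * \<bar>v $ i\<bar>) \<longlongrightarrow> 0 * \<bar>v $ i\<bar>) (at_right 0)"
      by (intro tendsto_intros)
    with False show ?thesis
      by (auto dest: order_tendstoD(2)[where a = "\<bar>u $ i\<bar>"])
  qed simp
  then have "\<forall>\<^sub>F t in at_right (0::real). t > 0 \<and> (\<forall>i. u $ i \<noteq> 0 \<longrightarrow> t * \<bar>v $ i\<bar> < \<bar>u $ i\<bar>)"
    by (intro eventually_conj eventually_at_right_less eventually_all_finite)
  then show thesis
    using that eventually_happens' trivial_limit_at_right_real by blast
qed

section \<open>The l1 norm under perturbation\<close>

lemma sgn_add_small: "\<bar>b\<bar> < \<bar>a\<bar> \<Longrightarrow> sgn (a + b) = sgn (a :: real)"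
  by (auto simp: sgn_if)

text \<open>This is the subgradient inequality for the absolute value; at \<open>a = 0\<close> the
  subgradient chosen is 0.\<close>

lemma abs_add_ge_sgn: "\<bar>a\<bar> + b * sgn a \<le> \<bar>a + b :: real\<bar>"
  by (auto simp: sgn_if)

lemma abs_add_small: "\<bar>b\<bar> < \<bar>a\<bar> \<Longrightarrow> \<bar>a + b\<bar> = \<bar>a\<bar> + b * sgn (a :: real)"
  by (auto simp: sgn_if)

lemma l1_norm_on_minus: "l1_norm_on I (- v) = l1_norm_on I v"
  by (simp add: l1_norm_on_def)

lemma l1_norm_on_scaleR: "t \<ge> 0 \<Longrightarrow> l1_norm_on I (t *\<^sub>R v) = t * l1_norm_on I v"
  by (simp add: l1_norm_on_def abs_mult sum_distrib_left)

lemma inner_on_minus_left: "inner_on I (- u) v = - inner_on I u v"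
  by (simp add: inner_on_def sum_negf)

lemma inner_on_scaleR_left: "inner_on I (t *\<^sub>R u) v = t * inner_on I u v"
  by (simp add: inner_on_def sum_distrib_left mult.assoc)

lemma l1_norm_split: "l1_norm v = l1_norm_on A v + l1_norm_on (- A) (v :: real^'p)"
  unfolding l1_norm_on_def by (subst sum.union_disjoint[symmetric]) (auto simp: Compl_partition)

text \<open>On \<open>A\<close> the vector \<open>u\<close> vanishes, so \<open>v\<close>
  contributes its full norm there; off \<open>A\<close> the subgradient inequality is summed over
  the entries.\<close>

lemma l1_norm_add_ge:
  fixes u v :: "real^'p"
  assumes "zero_on A u"
  shows "l1_norm u + l1_norm_on A v + inner_on (- A) v (sign_vec u) \<le> l1_norm (u + v)"
proof -
  have "l1_norm_on (- A) u + inner_on (- A) v (sign_vec u) \<le> l1_norm_on (- A) (u + v)"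
    by (auto simp: l1_norm_on_def inner_on_def sign_vec_def abs_add_ge_sgn
        simp flip: sum.distrib intro!: sum_mono)
  moreover have "l1_norm_on A u = 0" "l1_norm_on A (u + v) = l1_norm_on A v"
    using assms by (auto simp: l1_norm_on_def zero_on_def)
  ultimately show ?thesis
    by (simp add: l1_norm_split[of _ A])
qed

text \<open>The second hypothesis makes \<open>u\<close> nonzero off \<open>A\<close> and keeps
  \<open>v\<close> from changing a sign there, so the lower bound is attained.\<close>

lemma l1_norm_add_small:
  fixes u v :: "real^'p"
  assumes "zero_on A u" and "\<And>i. i \<notin> A \<Longrightarrow> \<bar>v $ i\<bar> < \<bar>u $ i\<bar>"
  shows "l1_norm (u + v) = l1_norm u + l1_norm_on A v + inner_on (- A) v (sign_vec u)"
proof -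
  have "l1_norm_on (- A) (u + v) = l1_norm_on (- A) u + inner_on (- A) v (sign_vec u)"
    using assms(2) by (auto simp: l1_norm_on_def inner_on_def sign_vec_def abs_add_small
        simp flip: sum.distrib intro!: sum.cong)
  moreover have "l1_norm_on A u = 0" "l1_norm_on A (u + v) = l1_norm_on A v"
    using assms(1) by (auto simp: l1_norm_on_def zero_on_def)
  ultimately show ?thesis
    by (simp add: l1_norm_split[of _ A])
qed

section \<open>Pointwise equivalence for a vector of exact cosupport\<close>

lemma matrix_vector_mult_minus_right: "A *v (- x) = - (A *v (x :: real^'n))"
  using matrix_vector_mult_diff_distrib[of A 0 x] by simp

lemma unique_minimizer_null_space_iff:
  fixes M :: "real^'d^'m" and \<Omega> :: "real^'d^'p"
  shows "unique_minimizer (\<lambda>x. l1_norm (\<Omega> *v x)) (\<lambda>x. M *v x = M *v x0) x0 \<longleftrightarrow>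
    (\<forall>z\<in>null_space M. z \<noteq> 0 \<longrightarrow> l1_norm (\<Omega> *v x0) < l1_norm (\<Omega> *v x0 + \<Omega> *v z))"
    (is "?L \<longleftrightarrow> ?R")
proof
  assume L: ?L
  show ?R
  proof (intro ballI impI)
    fix z assume "z \<in> null_space M" "z \<noteq> 0"
    then have "l1_norm (\<Omega> *v x0) < l1_norm (\<Omega> *v (x0 + z))"
      using L[unfolded unique_minimizer_iff, THEN conjunct2, rule_format, of "x0 + z"]
      by (simp add: null_space_def matrix_vector_right_distrib)
    then show "l1_norm (\<Omega> *v x0) < l1_norm (\<Omega> *v x0 + \<Omega> *v z)"
      by (simp add: matrix_vector_right_distrib)
  qed
next
  assume R: ?R
  have "l1_norm (\<Omega> *v x0) < l1_norm (\<Omega> *v x)" if "M *v x = M *v x0" "x \<noteq> x0" for x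
    using R[rule_format, of "x - x0"] that
    by (simp add: null_space_def matrix_vector_mult_diff_distrib)
  then show ?L
    by (simp add: unique_minimizer_iff)
qed

lemma unique_minimizer_iff_abs_inner_less:
  fixes M :: "real^'d^'m" and \<Omega> :: "real^'d^'p"
  assumes cosupp: "cosupport \<Omega> x = \<Lambda>"
  shows "unique_minimizer (\<lambda>y. l1_norm (\<Omega> *v y)) (\<lambda>y. M *v y = M *v x) x \<longleftrightarrow>
    (\<forall>z\<in>null_space M. z \<noteq> 0 \<longrightarrow>
      \<bar>inner_on (- \<Lambda>) (\<Omega> *v z) (sign_vec (\<Omega> *v x))\<bar> < l1_norm_on \<Lambda> (\<Omega> *v z))"
    (is "?L \<longleftrightarrow> ?R")
proof
  have zero: "zero_on \<Lambda> (\<Omega> *v x)"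
    using cosupp by (auto simp: cosupport_def zero_on_def)
  show ?R if L: ?L
  proof (intro ballI impI)
    have pos: "0 < l1_norm_on \<Lambda> (\<Omega> *v z) + inner_on (- \<Lambda>) (\<Omega> *v z) (sign_vec (\<Omega> *v x))"
      if z: "z \<in> null_space M" "z \<noteq> 0" for z
    proof -
      \<comment> \<open>Scaling \<open>z\<close> by \<open>t\<close> keeps it in the null space and
        puts it in the range where the l1 norm is exactly linear in \<open>t\<close>; dividing by
        \<open>t\<close> then gives the claim.\<close>
      obtain t where t: "t > 0"
        "\<And>i. (\<Omega> *v x) $ i \<noteq> 0 \<Longrightarrow> t * \<bar>(\<Omega> *v z) $ i\<bar> < \<bar>(\<Omega> *v x) $ i\<bar>"
        using ex_small_multiple by metis
      have "t *\<^sub>R z \<in> null_space M" "t *\<^sub>R z \<noteq> 0"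
        using z t(1) by (auto simp: null_space_def matrix_vector_mult_scaleR)
      then have "l1_norm (\<Omega> *v x) < l1_norm (\<Omega> *v x + t *\<^sub>R (\<Omega> *v z))"
        using L by (metis unique_minimizer_null_space_iff matrix_vector_mult_scaleR)
      also have "\<dots> = l1_norm (\<Omega> *v x) + t * l1_norm_on \<Lambda> (\<Omega> *v z)
          + t * inner_on (- \<Lambda>) (\<Omega> *v z) (sign_vec (\<Omega> *v x))"
        using t cosupp by (subst l1_norm_add_small[OF zero])
          (auto simp: abs_mult cosupport_def l1_norm_on_scaleR inner_on_scaleR_left)
      finally have "0 < t * (l1_norm_on \<Lambda> (\<Omega> *v z)
          + inner_on (- \<Lambda>) (\<Omega> *v z) (sign_vec (\<Omega> *v x)))"
        by (simp add: distrib_left)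
      then show ?thesis
        using t(1) by (simp add: zero_less_mult_iff)
    qed
    fix z assume z: "z \<in> null_space M" "z \<noteq> 0"
    \<comment> \<open>The norm is even and the inner product odd in \<open>z\<close>, so the bounds
      for \<open>z\<close> and \<open>- z\<close> combine into one on the absolute value.\<close>
    then have "- z \<in> null_space M" "- z \<noteq> 0"
      by (auto simp: null_space_def matrix_vector_mult_minus_right)
    from pos[OF z] pos[OF this]
    show "\<bar>inner_on (- \<Lambda>) (\<Omega> *v z) (sign_vec (\<Omega> *v x))\<bar> < l1_norm_on \<Lambda> (\<Omega> *v z)"
      by (simp add: matrix_vector_mult_minus_right l1_norm_on_minus inner_on_minus_left)
  qed
  show ?L if R: ?R
    unfolding unique_minimizer_null_space_iff
  proof (intro ballI impI)
    fix z assume "z \<in> null_space M" "z \<noteq> 0"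
    with R have "\<bar>inner_on (- \<Lambda>) (\<Omega> *v z) (sign_vec (\<Omega> *v x))\<bar> < l1_norm_on \<Lambda> (\<Omega> *v z)"
      by blast
    with l1_norm_add_ge[OF zero, of "\<Omega> *v z"]
    show "l1_norm (\<Omega> *v x) < l1_norm (\<Omega> *v x + \<Omega> *v z)"
      by linarith
  qed
qed

section \<open>From exact cosupport to the whole kernel and the supremum\<close>

lemma sign_vec_average_of_exact_cosupport:
  fixes \<Omega> :: "real^'d^'p"
  assumes y: "cosupport \<Omega> y = \<Lambda>" and x: "zero_on \<Lambda> (\<Omega> *v x)"
  obtains a b where "cosupport \<Omega> a = \<Lambda>" "cosupport \<Omega> b = \<Lambda>"
    "sign_vec (\<Omega> *v a) + sign_vec (\<Omega> *v b) = 2 *\<^sub>R sign_vec (\<Omega> *v x)"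
proof -
  let ?u = "\<Omega> *v x" and ?w = "\<Omega> *v y"
  obtain t where t: "t > 0" "\<And>i. ?u $ i \<noteq> 0 \<Longrightarrow> t * \<bar>?w $ i\<bar> < \<bar>?u $ i\<bar>"
    using ex_small_multiple by metis
  \<comment> \<open>This covers both \<open>s = t\<close> and \<open>s = - t\<close>. Where
    \<open>?u\<close> vanishes the two signs cancel; elsewhere both equal the sign of
    \<open>?u\<close>.\<close>
  have sgn: "sgn (?u $ i + s * ?w $ i) = (if ?u $ i = 0 then sgn s * sgn (?w $ i) else sgn (?u $ i))"
    if "\<bar>s\<bar> = t" for s i
    using t(2)[of i] that by (auto simp: sgn_mult abs_mult intro!: sgn_add_small)
  have image: "(\<Omega> *v (x + s *\<^sub>R y)) $ i = ?u $ i + s * ?w $ i" for s i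
    by (simp add: matrix_vector_right_distrib matrix_vector_mult_scaleR)
  have cosupp: "cosupport \<Omega> (x + s *\<^sub>R y) = \<Lambda>" if "\<bar>s\<bar> = t" for s
  proof -
    have "?u $ i + s * ?w $ i = 0 \<longleftrightarrow> ?w $ i = 0" for i
    proof -
      \<comment> \<open>A zero of \<open>?w\<close> lies in \<open>\<Lambda>\<close>, where
        \<open>?u\<close> vanishes too.\<close>
      have "?u $ i = 0" if "?w $ i = 0"
        using that x y by (auto simp: zero_on_def cosupport_def)
      then show ?thesis
        using sgn_zero_iff[of "?u $ i + s * ?w $ i"] sgn[OF that, of i] that t(1)
        by (auto simp: sgn_zero_iff split: if_splits)
    qed
    then show ?thesis
      using y by (auto simp: cosupport_def image)
  qed
  show thesis
  proof (rule that)
    show "cosupport \<Omega> (x + t *\<^sub>R y) = \<Lambda>" "cosupport \<Omega> (x + (- t) *\<^sub>R y) = \<Lambda>"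
      using t(1) by (auto intro!: cosupp simp del: scaleR_minus_left)
    show "sign_vec (\<Omega> *v (x + t *\<^sub>R y)) + sign_vec (\<Omega> *v (x + (- t) *\<^sub>R y))
        = 2 *\<^sub>R sign_vec ?u"
      unfolding vec_eq_iff sign_vec_def vector_add_component vector_scaleR_component
        vec_lambda_beta image
      using t(1) by (subst (1 2) sgn) auto
  qed
qed

text \<open>The pairing is linear in the sign vector, so its value at \<open>x\<close> is the mean
  of two values in the open interval from \<open>- c\<close> to \<open>c\<close>.\<close>

lemma abs_inner_sign_less_of_exact_cosupport:
  fixes \<Omega> :: "real^'d^'p"
  assumes "cosupport \<Omega> y = \<Lambda>" and "zero_on \<Lambda> (\<Omega> *v x)"
    and less: "\<And>a. cosupport \<Omega> a = \<Lambda> \<Longrightarrow> \<bar>inner_on I v (sign_vec (\<Omega> *v a))\<bar> < c"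
  shows "\<bar>inner_on I v (sign_vec (\<Omega> *v x))\<bar> < c"
proof -
  obtain a b where ab: "cosupport \<Omega> a = \<Lambda>" "cosupport \<Omega> b = \<Lambda>"
    and avg: "sign_vec (\<Omega> *v a) + sign_vec (\<Omega> *v b) = 2 *\<^sub>R sign_vec (\<Omega> *v x)"
    using sign_vec_average_of_exact_cosupport[OF assms(1,2)] .
  have "inner_on I v (sign_vec (\<Omega> *v a)) + inner_on I v (sign_vec (\<Omega> *v b))
      = inner_on I v (sign_vec (\<Omega> *v a) + sign_vec (\<Omega> *v b))"
    by (simp add: inner_on_def distrib_left sum.distrib)
  also have "\<dots> = 2 * inner_on I v (sign_vec (\<Omega> *v x))"
    unfolding avg by (simp add: inner_on_def sum_distrib_left mult_ac)
  finally show ?thesis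
    using less[OF ab(1)] less[OF ab(2)] by linarith
qed

text \<open>Only finitely many values occur, so the supremum is a maximum and the strict bound
  passes to it.\<close>

lemma SUP_abs_inner_sign_less_iff:
  fixes \<Omega> :: "real^'d^'p"
  shows "(SUP x\<in>{x. zero_on \<Lambda> (\<Omega> *v x)}. \<bar>inner_on I v (sign_vec (\<Omega> *v x))\<bar>) < c \<longleftrightarrow>
    (\<forall>x. zero_on \<Lambda> (\<Omega> *v x) \<longrightarrow> \<bar>inner_on I v (sign_vec (\<Omega> *v x))\<bar> < c)"
proof -
  let ?K = "{x. zero_on \<Lambda> (\<Omega> *v x)}"
  let ?S = "(\<lambda>x. \<bar>inner_on I v (sign_vec (\<Omega> *v x))\<bar>) ` ?K"
  have "?S \<subseteq> (\<lambda>s. \<bar>inner_on I v s\<bar>) ` range sign_vec"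
    by blast
  then have "finite ?S"
    by (rule finite_subset) (intro finite_imageI finite_range_sign_vec)
  moreover have "?S \<noteq> {}"
    using sign_pairing_sup_well_defined(1) by blast
  ultimately have "Sup ?S < c \<longleftrightarrow> (\<forall>s\<in>?S. s < c)"
    by (rule finite_Sup_less_iff)
  then show ?thesis
    by blast
qed

theorem theorem7:
  fixes M :: "real^'d^'m" and \<Omega> :: "real^'d^'p" and \<Lambda> :: "'p set"
  assumes "CARD('m) < CARD('d)"
    and "rows_lin_indep M"
    and "\<exists>x. cosupport \<Omega> x = \<Lambda>"
  shows "(\<forall>x0. cosupport \<Omega> x0 = \<Lambda> \<longrightarrow>
            unique_minimizer (\<lambda>x. l1_norm (\<Omega> *v x)) (\<lambda>x. M *v x = M *v x0) x0)
     \<longleftrightarrow>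
         (\<forall>z\<in>null_space M. z \<noteq> 0 \<longrightarrow>
            (SUP x\<in>{x. zero_on \<Lambda> (\<Omega> *v x)}.
               \<bar>inner_on (- \<Lambda>) (\<Omega> *v z) (sign_vec (\<Omega> *v x))\<bar>)
            < l1_norm_on \<Lambda> (\<Omega> *v z))"
proof -
  \<comment> \<open>This vector is the direction in which kernel elements are perturbed to exact
    cosupport.\<close>
  obtain y where y: "cosupport \<Omega> y = \<Lambda>"
    using assms(3) by blast
  have sup_iff: "(SUP x\<in>{x. zero_on \<Lambda> (\<Omega> *v x)}. \<bar>inner_on (- \<Lambda>) v (sign_vec (\<Omega> *v x))\<bar>) < c \<longleftrightarrow>
      (\<forall>x. cosupport \<Omega> x = \<Lambda> \<longrightarrow> \<bar>inner_on (- \<Lambda>) v (sign_vec (\<Omega> *v x))\<bar> < c)" for v c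
  proof -
    have "zero_on \<Lambda> (\<Omega> *v x)" if "cosupport \<Omega> x = \<Lambda>" for x
      using that by (auto simp: cosupport_def zero_on_def)
    then show ?thesis
      unfolding SUP_abs_inner_sign_less_iff
      using abs_inner_sign_less_of_exact_cosupport[OF y, of _ "- \<Lambda>" v c] by metis
  qed
  show ?thesis
    \<comment> \<open>What remains is to exchange the universal quantifiers over \<open>x0\<close>
      and \<open>z\<close>.\<close>
    unfolding sup_iff using unique_minimizer_iff_abs_inner_less[of \<Omega> _ \<Lambda> M] by blast
qed

end
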